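(* For each integer $n \geq 2$ let $\mathcal{D}_n$ be the uniform distribution on $\{2, \dots, n\}$, let $m_n$ be a positive integer, and let $S_n = ((X_1, r(X_1)), \dots, (X_{m_n}, r(X_{m_n})))$ where $X_1, \dots, X_{m_n}$ are i.i.d. from $\mathcal{D}_n$. Let $W_{t,n}$ be the weight of the $t$-th round AdaBoost hypothesis based on the sample $S_n$ with base hypothesis class $\mathcal{H}'$. Suppose that $m_n = \omega\big((\log n)^3\big)$. Then for all $t \in \mathbb{N}$, \[ W_{t,n} \to 0 \quad \text{almost surely as } n \to \infty . \]
   Context: $\mathbb{N}$ is the set of positive integers and $\mathcal{X} = \{n \in \mathbb{N} : n \geq 2\}$. Labels are taken in $\{-1, 1\}$. For a prime $p$ define $h_p : \mathcal{X} \to \{-1,1\}$ by $h_p(x) = -1$ if $p \mid x$ and $x > p$, and $h_p(x) = 1$ otherwise; let $\mathcal{H}' = \{h_p : p \text{ prime}\}$. The prime labeling function is $r(x) = 1$ if $x$ is prime and $r(x) = -1$ otherwise. For positive functions, $f(n) = \omega(g(n))$ means $\lim_{n \to \infty} f(n)/g(n) = \infty$. AdaBoost on the sample $S_n$: set $D^{(1)}_i = 1/m_n$ for $i = 1, \dots, m_n$. At round $t = 1, 2, \dots$ let \[ \epsilon_{t,n} = \min_{h \in \mathcal{H}'} \sum_{i=1}^{m_n} D^{(t)}_i \mathbf{1}\{h(X_i) \neq r(X_i)\}, \] let $h_t \in \mathcal{H}'$ be the hypothesis attaining this minimum (ties broken by taking the smallest prime), let \[ W_{t,n} = \frac12 \log\Big(\frac{1}{\epsilon_{t,n}}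 - 1\Big), \] and update \[ D^{(t+1)}_i = \frac{D^{(t)}_i e^{-W_{t,n} r(X_i) h_t(X_i)}}{\sum_{j=1}^{m_n} D^{(t)}_j e^{-W_{t,n} r(X_j) h_t(X_j)}} . \] If $\epsilon_{t,n} = 0$ at some round $t$, the procedure stops and $W_{s,n} := +\infty$ for all $s \geq t$. The samples $S_n$ for different $n$ are defined on a common probability space, with no assumption on their joint dependence across $n$. *)

theory Defs
  imports "HOL-Probability.Probability" "HOL-Computational_Algebra.Primes"
begin

definition prime_hyp :: "nat \<Rightarrow> nat \<Rightarrow> int" where
  "prime_hyp p x = (if p dvd x \<and> x > p then -1 else 1)"

definition hyp_class :: "(nat \<Rightarrow> int) set" where
  "hyp_class = {prime_hyp p |p. prime p}"

definition prime_label :: "nat \<Rightarrow> int" where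
  "prime_label x = (if prime x then 1 else -1)"

text \<open>
  A sample of size \<open>m\<close> is a function \<open>x :: nat \<Rightarrow> nat\<close>, of which only the values at the indices
  \<open>1, \<dots>, m\<close> are used; the label of \<open>x i\<close> is \<open>prime_label (x i)\<close>.  A weighting of the sample
  is a function \<open>D :: nat \<Rightarrow> real\<close> on the same indices.
\<close>

definition weighted_error ::
    "nat \<Rightarrow> (nat \<Rightarrow> nat) \<Rightarrow> (nat \<Rightarrow> real) \<Rightarrow> (nat \<Rightarrow> int) \<Rightarrow> real" where
  "weighted_error m x D h = (\<Sum>i=1..m. D i * of_bool (h (x i) \<noteq> prime_label (x i)))"

definition min_error :: "nat \<Rightarrow> (nat \<Rightarrow> nat) \<Rightarrow> (nat \<Rightarrow> real) \<Rightarrow> real" where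
  "min_error m x D = Min (weighted_error m x D ` hyp_class)"

text \<open>
  The class is infinite, but the error only depends on the set of misclassified indices, so
  the minimum is over a finite nonempty set of values and is attained.
\<close>

lemma finite_weighted_error_image: "finite (weighted_error m x D ` H)"
proof (rule finite_subset)
  show "weighted_error m x D ` H \<subseteq> sum D ` Pow {1..m}"
  proof
    fix e assume "e \<in> weighted_error m x D ` H"
    then obtain h where "e = weighted_error m x D h" by blast
    also have "\<dots> = (\<Sum>i\<in>{1..m}. if h (x i) \<noteq> prime_label (x i) then D i else 0)"
      unfolding weighted_error_def by (intro sum.cong) auto
    also have "\<dots> = sum D {i \<in> {1..m}. h (x i) \<noteq> prime_label (x i)}"
      by (rule sum.inter_filter[symmetric]) simp
    finally show "e \<in> sum D ` Pow {1..m}" by (intro image_eqI[where x = "{i \<in> {1..m}. h (x i) \<noteq> prime_label (x i)}"]) auto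
  qed
qed simp

lemma hyp_class_nonempty: "hyp_class \<noteq> {}"
  unfolding hyp_class_def using two_is_prime_nat by blast

lemma min_error_attained: "\<exists>p. prime p \<and> weighted_error m x D (prime_hyp p) = min_error m x D"
proof -
  have "min_error m x D \<in> weighted_error m x D ` hyp_class"
    unfolding min_error_def
    by (intro Min_in finite_weighted_error_image) (simp add: hyp_class_nonempty)
  then obtain h where "h \<in> hyp_class" "min_error m x D = weighted_error m x D h"
    by (rule imageE)
  then show ?thesis unfolding hyp_class_def by auto
qed

definition best_hyp :: "nat \<Rightarrow> (nat \<Rightarrow> nat) \<Rightarrow> (nat \<Rightarrow> real) \<Rightarrow> nat \<Rightarrow> int" where
  "best_hyp m x D =
     prime_hyp (LEAST p. prime p \<and> weighted_error m x D (prime_hyp p) = min_error m x D)"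

definition hyp_weight :: "real \<Rightarrow> real" where
  "hyp_weight \<epsilon> = 1 / 2 * ln (1 / \<epsilon> - 1)"

definition reweight :: "nat \<Rightarrow> (nat \<Rightarrow> nat) \<Rightarrow> (nat \<Rightarrow> real) \<Rightarrow> nat \<Rightarrow> real" where
  "reweight m x D i =
     (let w = hyp_weight (min_error m x D);
          f = (\<lambda>j. D j * exp (- w * prime_label (x j) * best_hyp m x D (x j)))
      in f i / (\<Sum>j=1..m. f j))"

text \<open>
  \<open>adaboost_dist m x k\<close> is the distribution used in round \<open>k + 1\<close>, that is, \<open>D\<close> after \<open>k\<close>
  updates.  Rounds are numbered from 1.
\<close>

primrec adaboost_dist :: "nat \<Rightarrow> (nat \<Rightarrow> nat) \<Rightarrow> nat \<Rightarrow> nat \<Rightarrow> real" where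
  "adaboost_dist m x 0 = (\<lambda>i. 1 / real m)"
| "adaboost_dist m x (Suc k) = reweight m x (adaboost_dist m x k)"

definition adaboost_error :: "nat \<Rightarrow> (nat \<Rightarrow> nat) \<Rightarrow> nat \<Rightarrow> real" where
  "adaboost_error m x t = min_error m x (adaboost_dist m x (t - 1))"

text \<open>
  Once a round has error 0 the procedure stops and all weights from that round on are \<open>\<infinity>\<close>; the
  values of \<open>adaboost_dist\<close> beyond that point are arbitrary, and unused.  In every earlier round
  all entries of \<open>D\<close> are positive with sum 1, and each \<open>x i \<ge> 2\<close> is classified correctly
  by some hypothesis (\<open>p = x i\<close> if \<open>x i\<close> is prime, a prime factor of \<open>x i\<close> otherwise).  The error
  is therefore in \<open>{0<..<1}\<close> and the logarithm is applied to a positive number.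
\<close>

definition adaboost_weight :: "nat \<Rightarrow> (nat \<Rightarrow> nat) \<Rightarrow> nat \<Rightarrow> ereal" where
  "adaboost_weight m x t =
     (if \<exists>s\<in>{1..t}. adaboost_error m x s = 0 then \<infinity>
      else ereal (hyp_weight (adaboost_error m x t)))"

end

theory Submission
  imports Defs "HOL-Real_Asymp.Real_Asymp"
begin

text \<open>
  A hypothesis \<open>h\<^sub>p\<close> labels every prime correctly, and it errs on a composite number exactly when
  \<open>p\<close> does not divide it.  Under the uniform distribution on \<open>{2..n}\<close> the error of \<open>h\<^sub>2\<close> is
  therefore at most the density of the odd numbers, which is at most \<open>1/2\<close>.  The error of any
  \<open>h\<^sub>p\<close> is at least 1 minus the density of the primes minus the density of the multiples of
  \<open>p\<close>.  The primes have density zero, and the multiples of \<open>p\<close> have density about \<open>1/p\<close>, so this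
  is at least \<open>1/2 - o(1)\<close>, uniformly in \<open>p\<close>.  So the smallest error tends to \<open>1/2\<close>.

  The same holds on the samples.  The argument refers only to the frequencies of the primes, of
  the odd numbers and of the multiples of each \<open>p \<le> n\<close>, which are at most \<open>n + 1\<close> events.
  Hoeffding's inequality bounds the probability that one of these frequencies exceeds its
  expectation by \<open>\<delta>\<close> by \<open>exp (- 2 \<delta>\<^sup>2 m)\<close>.  Since \<open>m\<close> grows faster than \<open>ln n\<close>, the sum of these
  bounds over the events is \<open>O(1/n\<^sup>2)\<close>, hence summable in \<open>n\<close>, and the lemma of Borel and Cantelli
  turns this into an almost sure statement (\<open>AE_eventually_empirical_freq_less\<close>).  It follows that
  the error of the first round tends to \<open>1/2\<close> almost surely
  (\<open>uniform_min_error_tendsto_half\<close>).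

  All later rounds follow from the first without further probability theory.  An error close to
  \<open>1/2\<close> gives a weight close to 0, and an update with a weight close to 0 hardly changes the
  distribution.  By induction, the distribution of any fixed round is uniform up to factors that
  tend to 1 (\<open>adaboost_dist_near_uniform\<close>).  Such factors do not change the limit of the smallest
  error, so in every round the error tends to \<open>1/2\<close> and the weight tends to 0.
\<close>

section \<open>The primes have density zero\<close>

lemma prod_primes_dvd:
  fixes A :: "nat set"
  assumes "finite A" "\<And>p. p \<in> A \<Longrightarrow> prime p" "\<And>p. p \<in> A \<Longrightarrow> p dvd k"
  shows "\<Prod>A dvd k"
  using assms
proof (induction A rule: finite_induct)
  case (insert q A)
  have "coprime q (\<Prod>A)"
    using insert by (intro prod_coprime_right) (metis insertCI primes_coprime)
  thus ?case using insert by (simp add: divides_mult)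
qed simp

lemma prime_dvd_binomial_odd:
  assumes "prime p" "Suc k < p" "p \<le> 2 * k + 1"
  shows "p dvd (2 * k + 1) choose k"
proof -
  have "fact k * fact (2 * k + 1 - k) * ((2 * k + 1) choose k) = (fact (2 * k + 1) :: nat)"
    by (rule binomial_fact_lemma) simp
  moreover have "p dvd (fact (2 * k + 1) :: nat)"
    using assms by (simp add: prime_dvd_fact_iff del: fact_Suc)
  moreover have "\<not> p dvd (fact k :: nat)" "\<not> p dvd (fact (2 * k + 1 - k) :: nat)"
    using assms by (simp_all add: prime_dvd_fact_iff del: fact_Suc)
  ultimately show ?thesis
    using assms(1) by (metis prime_dvd_mult_iff)
qed

text \<open>
  The binomial coefficients with lower index at most \<open>k\<close> are half of the row \<open>2 * k + 1\<close>, whose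
  sum is \<open>2 ^ (2 * k + 1)\<close>.
\<close>

lemma binomial_odd_le: "(2 * k + 1) choose k \<le> 4 ^ k"
proof -
  have "(2 * k + 1) choose k \<le> (\<Sum>j\<le>k. (2 * k + 1) choose j)"
    by (rule member_le_sum) auto
  also have "\<dots> = 4 ^ k"
    using binomial_r_part_sum[of k] by (simp add: power_mult)
  finally show ?thesis .
qed

text \<open>
  Chebyshev's bound, by the argument of Erdos: the primes in \<open>{k + 2..2 * k + 1}\<close> all divide
  \<open>(2 * k + 1) choose k\<close>, which is at most \<open>4 ^ k\<close>, so the bound for \<open>k + 1\<close> gives the one
  for \<open>2 * k + 1\<close>.
\<close>

lemma primorial_le: "\<Prod>{p::nat. prime p \<and> p \<le> n} \<le> 4 ^ n"
proof (induction n rule: less_induct)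
  case (less n)
  have fin: "finite {p::nat. prime p \<and> p \<le> k}" for k
    by (rule finite_subset[of _ "{..k}"]) auto
  consider "n \<le> 1" | "n = 2" | "n > 2" "even n" | k where "k \<ge> 1" "n = 2 * k + 1"
  proof (cases "odd n \<and> n > 1")
    case True
    then obtain k where "n = 2 * k + 1" by (auto elim: oddE)
    with True show ?thesis by (intro that(4)[of k]) auto
  next
    case False
    hence "n \<le> 1 \<or> n = 2 \<or> n > 2 \<and> even n" by auto
    thus ?thesis using that(1-3) by blast
  qed
  then show ?case
  proof cases
    case 1
    hence none: "{p::nat. prime p \<and> p \<le> n} = {}"
      by (auto dest: prime_gt_1_nat)
    show ?thesis unfolding none by simp
  next
    case 2
    have only_2: "{p::nat. prime p \<and> p \<le> 2} = {2}"
      by (auto dest: prime_ge_2_nat)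
    show ?thesis unfolding 2 only_2 by simp
  next
    case 3
    hence "\<not> prime n"
      by (metis prime_odd_nat)
    hence "{p::nat. prime p \<and> p \<le> n} = {p. prime p \<and> p \<le> n - 1}"
      using 3 by (auto simp: le_diff_conv2 Suc_le_eq intro: le_neq_implies_less)
    also have "\<Prod>\<dots> \<le> 4 ^ (n - 1)"
      using 3 by (intro less) auto
    also have "\<dots> \<le> (4::nat) ^ n"
      by (intro power_increasing) auto
    finally show ?thesis .
  next
    case 4
    define B where "B = {p. prime p \<and> Suc k < p \<and> p \<le> 2 * k + 1}"
    have "finite B" unfolding B_def by (rule finite_subset[of _ "{..2*k+1}"]) auto
    have "\<Prod>B dvd (2 * k + 1) choose k"
      using \<open>finite B\<close> by (rule prod_primes_dvd) (auto simp: B_def intro: prime_dvd_binomial_odd[simplified])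
    hence "\<Prod>B \<le> 4 ^ k"
      by (intro order.trans[OF dvd_imp_le binomial_odd_le]) simp_all
    have "{p::nat. prime p \<and> p \<le> n} = {p. prime p \<and> p \<le> Suc k} \<union> B"
      using 4 by (auto simp: B_def)
    moreover have "{p. prime p \<and> p \<le> Suc k} \<inter> B = {}"
      by (auto simp: B_def)
    ultimately have "\<Prod>{p::nat. prime p \<and> p \<le> n} = \<Prod>{p. prime p \<and> p \<le> Suc k} * \<Prod>B"
      using fin \<open>finite B\<close> by (simp add: prod.union_disjoint)
    also have "\<dots> \<le> 4 ^ Suc k * 4 ^ k"
      using 4 \<open>\<Prod>B \<le> 4 ^ k\<close> by (intro mult_mono less) auto
    also have "\<dots> = 4 ^ n"
      using 4 by (simp add: mult_2 power_add)
    finally show ?thesis .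
  qed
qed

text \<open>
  Each prime in \<open>{4 ^ L<..n}\<close> contributes a factor of at least \<open>4 ^ L\<close> to a product that is at
  most \<open>4 ^ n\<close>, so there are at most \<open>n / L\<close> of them.  Since \<open>L\<close> is arbitrary, this form yields
  density zero without logarithms.
\<close>

lemma prime_count_le:
  "L * card {p::nat. prime p \<and> p \<le> n} \<le> n + L * 4 ^ L"
proof -
  let ?P = "{p::nat. prime p \<and> p \<le> n}"
  let ?Q = "{p \<in> ?P. 4 ^ L < p}"
  have fin: "finite ?P"
    by (rule finite_subset[of _ "{..n}"]) auto
  have "(4 ^ L) ^ card ?Q \<le> \<Prod>?Q"
    by (subst prod_constant[symmetric], rule prod_mono) auto
  also have "\<dots> \<le> \<Prod>?P"
    using fin by (intro dvd_imp_le prod_dvd_prod_subset prod_pos) (auto dest: prime_gt_0_nat)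
  also have "\<dots> \<le> 4 ^ n"
    by (rule primorial_le)
  finally have "L * card ?Q \<le> n"
    by (simp flip: power_mult)
  moreover have "card ?P \<le> card ?Q + 4 ^ L"
  proof -
    have "card ?P \<le> card (?Q \<union> {1..4 ^ L})"
      using fin by (intro card_mono) (auto dest: prime_ge_1_nat)
    also have "\<dots> \<le> card ?Q + card {1..(4::nat) ^ L}"
      by (rule card_Un_le)
    finally show ?thesis by simp
  qed
  hence "L * card ?P \<le> L * card ?Q + L * 4 ^ L"
    by (metis mult_le_mono2 distrib_left)
  ultimately show ?thesis by linarith
qed

lemma prob_uniform:
  assumes "n \<ge> 2"
  shows "measure_pmf.prob (pmf_of_set {2..n}) A = real (card ({2..n} \<inter> A)) / (real n - 1)"
  using assms by (subst measure_pmf_of_set) (auto simp: of_nat_diff)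

lemma prob_prime_tendsto_0:
  "(\<lambda>n. measure_pmf.prob (pmf_of_set {2..n}) {x. prime x}) \<longlonglongrightarrow> 0"
proof (rule order_tendstoI)
  fix a :: real assume "a < 0"
  thus "\<forall>\<^sub>F n in sequentially. a < measure_pmf.prob (pmf_of_set {2..n}) {x. prime x}"
    by (intro always_eventually allI) (meson less_le_trans measure_nonneg)
next
  fix a :: real assume "0 < a"
  then obtain l where "1 / real (Suc l) < a"
    by (rule nat_approx_posE)
  then obtain L where L: "L > 0" "1 / real L < a"
    by blast
  have "(\<lambda>n. (real n / real L + 4 ^ L) / (real n - 1)) \<longlonglongrightarrow> inverse (real L)"
    using L by real_asymp
  hence "\<forall>\<^sub>F n in sequentially. (real n / real L + 4 ^ L) / (real n - 1) < a"
    using L by (intro order_tendstoD) (auto simp: inverse_eq_divide)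
  thus "\<forall>\<^sub>F n in sequentially. measure_pmf.prob (pmf_of_set {2..n}) {x. prime x} < a"
    using eventually_ge_at_top[of 2]
  proof eventually_elim
    case (elim n)
    have "{2..n} \<inter> {x. prime x} = {p. prime p \<and> p \<le> n}"
      by (auto dest: prime_ge_2_nat)
    moreover have "real (card {p. prime p \<and> p \<le> n}) \<le> real n / real L + 4 ^ L"
    proof -
      have "real (L * card {p. prime p \<and> p \<le> n}) \<le> real (n + L * 4 ^ L)"
        by (intro of_nat_mono prime_count_le)
      thus ?thesis using L by (simp add: field_simps)
    qed
    ultimately have "measure_pmf.prob (pmf_of_set {2..n}) {x. prime x}
        \<le> (real n / real L + 4 ^ L) / (real n - 1)"
      using elim by (simp add: prob_uniform divide_right_mono)
    with elim show ?case by simp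
  qed
qed

lemma prob_multiple_le:
  assumes "n \<ge> 2" "p \<ge> 2"
  shows "measure_pmf.prob (pmf_of_set {2..n}) {x. p dvd x} \<le> (real n / 2) / (real n - 1)"
proof -
  have "{2..n} \<inter> {x. p dvd x} \<subseteq> (\<lambda>k. p * k) ` {1..n div 2}"
  proof
    fix x assume x: "x \<in> {2..n} \<inter> {x. p dvd x}"
    then obtain k where k: "x = p * k" by (auto elim: dvdE)
    have "2 * k \<le> p * k" using assms by (intro mult_le_mono1)
    hence "k \<in> {1..n div 2}" using x k by (cases k) auto
    thus "x \<in> (\<lambda>k. p * k) ` {1..n div 2}" using k by blast
  qed
  hence "card ({2..n} \<inter> {x. p dvd x}) \<le> card {1..n div 2}"
    by (rule surj_card_le[rotated]) simp
  hence "real (card ({2..n} \<inter> {x. p dvd x})) \<le> real n / 2"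
    by simp
  hence "real (card ({2..n} \<inter> {x. p dvd x})) / (real n - 1) \<le> (real n / 2) / (real n - 1)"
    using assms by (intro divide_right_mono) auto
  thus ?thesis using assms by (subst prob_uniform)
qed

text \<open>
  The map \<open>x \<mapsto> x - 1\<close> sends the odd numbers of \<open>{2..n}\<close> injectively to even ones.
\<close>

lemma prob_odd_le:
  fixes n :: nat
  assumes "n \<ge> 2"
  shows "measure_pmf.prob (pmf_of_set {2..n}) {x. odd x} \<le> 1 / 2"
proof -
  have "card ({2..n} \<inter> {x. odd x}) \<le> card ({2..n} \<inter> {x. even x})"
  proof (rule card_inj_on_le[where f = "\<lambda>x. x - 1"])
    show "inj_on (\<lambda>x. x - 1) ({2..n} \<inter> {x. odd x})"
      by (auto simp: inj_on_def)
    show "(\<lambda>x. x - 1) ` ({2..n} \<inter> {x. odd x}) \<subseteq> {2..n} \<inter> {x. even x}"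
      by (auto elim!: oddE)
  qed simp
  moreover have "card ({2..n} \<inter> {x. odd x}) + card ({2..n} \<inter> {x. even x}) = n - 1"
    using card_Int_Diff[of "{2..n}" "{x. odd x}"]
    by (simp add: set_diff_eq Int_def)
  ultimately show ?thesis
    using assms by (subst prob_uniform) (auto simp: field_simps of_nat_diff)
qed

section \<open>Empirical frequencies\<close>

definition empirical_freq :: "nat \<Rightarrow> (nat \<Rightarrow> 'b) \<Rightarrow> 'b set \<Rightarrow> real" where
  "empirical_freq m x A = (\<Sum>i=1..m. of_bool (x i \<in> A)) / real m"

lemma (in prob_space) empirical_freq_tail:
  fixes X :: "nat \<Rightarrow> 'a \<Rightarrow> 'b"
  assumes m: "m \<ge> 1" and "\<delta> \<ge> 0"
    and indep: "indep_vars (\<lambda>_. count_space UNIV) X {1..m}"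
    and distr: "\<And>i. i \<in> {1..m} \<Longrightarrow> distr M (count_space UNIV) (X i) = measure_pmf P"
  shows "prob {\<omega> \<in> space M. empirical_freq m (\<lambda>i. X i \<omega>) A \<ge> measure_pmf.prob P A + \<delta>}
           \<le> exp (- 2 * \<delta>\<^sup>2 * real m)"
proof -
  have rv [measurable]: "X i \<in> measurable M (count_space UNIV)" if "i \<in> {1..m}" for i
    using indep that by (auto simp: indep_vars_def)
  have expec: "expectation (\<lambda>\<omega>. indicat_real A (X i \<omega>)) = measure_pmf.prob P A"
    if i: "i \<in> {1..m}" for i
  proof -
    have "expectation (\<lambda>\<omega>. indicat_real A (X i \<omega>))
        = (\<integral>x. indicat_real A x \<partial>distr M (count_space UNIV) (X i))"
      using i by (subst integral_distr) auto
    also have "\<dots> = measure_pmf.prob P A"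
      using i by (simp add: distr)
    finally show ?thesis .
  qed
  interpret H: Hoeffding_ineq M "{1..m}" "\<lambda>i \<omega>. indicat_real A (X i \<omega>)" "\<lambda>_. 0" "\<lambda>_. 1"
    "real m * measure_pmf.prob P A"
  proof unfold_locales
    show "indep_vars (\<lambda>_. borel) (\<lambda>i \<omega>. indicat_real A (X i \<omega>)) {1..m}"
      by (rule indep_vars_compose2[OF indep]) auto
    show "real m * measure_pmf.prob P A
        \<equiv> (\<Sum>i\<in>{1..m}. expectation (\<lambda>\<omega>. indicat_real A (X i \<omega>)))"
      by (rule eq_reflection) (simp add: expec)
  qed (auto simp: indicator_def)
  have "{\<omega> \<in> space M. empirical_freq m (\<lambda>i. X i \<omega>) A \<ge> measure_pmf.prob P A + \<delta>}
      = {\<omega> \<in> space M. (\<Sum>i\<in>{1..m}. indicat_real A (X i \<omega>))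
                         \<ge> real m * measure_pmf.prob P A + real m * \<delta>}"
    using m by (auto simp: empirical_freq_def indicator_def of_bool_def field_simps)
  also have "prob \<dots> \<le> exp (- 2 * (real m * \<delta>)\<^sup>2 / (\<Sum>i\<in>{1..m}. (1 - 0)\<^sup>2))"
    using m \<open>\<delta> \<ge> 0\<close> by (intro H.Hoeffding_ineq_ge) auto
  also have "\<dots> = exp (- 2 * \<delta>\<^sup>2 * real m)"
    using m by (simp add: power2_eq_square field_simps)
  finally show ?thesis .
qed

text \<open>
  A one-sided strong law that is uniform over a number of events growing linearly with \<open>n\<close>.  The
  samples for different \<open>n\<close> may depend on each other arbitrarily, since they are combined only
  through the convergence part of the lemma of Borel and Cantelli.
\<close>

lemma (in prob_space) AE_eventually_empirical_freq_less:
  fixes X :: "nat \<Rightarrow> nat \<Rightarrow> 'a \<Rightarrow> 'b" and P :: "nat \<Rightarrow> 'b pmf" and A :: "nat \<Rightarrow> 'b set"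
  assumes m: "\<And>n. n \<ge> 2 \<Longrightarrow> m n \<ge> 1"
    and indep: "\<And>n. n \<ge> 2 \<Longrightarrow> indep_vars (\<lambda>_. count_space UNIV) (X n) {1..m n}"
    and distr: "\<And>n i. n \<ge> 2 \<Longrightarrow> i \<in> {1..m n} \<Longrightarrow>
      distr M (count_space UNIV) (X n i) = measure_pmf (P n)"
    and growth: "filterlim (\<lambda>n. real (m n) / ln (real n)) at_top sequentially"
    and "\<delta> > 0"
  shows "AE \<omega> in M. \<forall>\<^sub>F n in sequentially. \<forall>j\<le>n.
           empirical_freq (m n) (\<lambda>i. X n i \<omega>) (A j) < measure_pmf.prob (P n) (A j) + \<delta>"
proof -
  define bad where "bad = (\<lambda>n j. {\<omega> \<in> space M.
    empirical_freq (m n) (\<lambda>i. X n i \<omega>) (A j) \<ge> measure_pmf.prob (P n) (A j) + \<delta>})"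
  define B where "B = (\<lambda>n. if n < 2 then {} else \<Union>j\<le>n. bad n j)"
  have bad_sets: "bad n j \<in> sets M" if "n \<ge> 2" for n j
  proof -
    have [measurable]: "X n i \<in> measurable M (count_space UNIV)" if "i \<in> {1..m n}" for i
      using indep[OF \<open>n \<ge> 2\<close>] that by (auto simp: indep_vars_def)
    have "(\<lambda>\<omega>. empirical_freq (m n) (\<lambda>i. X n i \<omega>) (A j)) \<in> borel_measurable M"
      unfolding empirical_freq_def
      by (intro borel_measurable_divide borel_measurable_sum borel_measurable_const)
         (rule measurable_compose[where N = "count_space UNIV"], auto)
    thus ?thesis unfolding bad_def by measurable
  qed
  hence B_sets: "B n \<in> sets M" for n
    by (auto simp: B_def)
  have B_prob: "prob (B n) \<le> real (Suc n) * exp (- 2 * \<delta>\<^sup>2 * real (m n))" if "n \<ge> 2" for n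
  proof -
    have "prob (B n) \<le> (\<Sum>j\<le>n. prob (bad n j))"
      using that bad_sets by (auto simp: B_def intro!: finite_measure_subadditive_finite)
    also have "\<dots> \<le> (\<Sum>j\<le>n. exp (- 2 * \<delta>\<^sup>2 * real (m n)))"
      unfolding bad_def using that \<open>\<delta> > 0\<close> m indep distr
      by (intro sum_mono empirical_freq_tail) auto
    finally show ?thesis by simp
  qed
  \<comment> \<open>The threshold makes each tail at most \<open>1/n\<^sup>4\<close>; the \<open>n + 1\<close> events then still leave a summable
    bound.\<close>
  have "\<forall>\<^sub>F n in sequentially. real (m n) / ln (real n) \<ge> 2 / \<delta>\<^sup>2"
    using growth by (simp add: filterlim_at_top)
  hence "\<forall>\<^sub>F n in sequentially. norm (prob (B n)) \<le> real (Suc n) / real n ^ 4"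
    using eventually_ge_at_top[of 2]
  proof eventually_elim
    case (elim n)
    have "ln (real n) > 0" using elim by simp
    hence "4 * ln (real n) \<le> 2 * \<delta>\<^sup>2 * real (m n)"
      using elim \<open>\<delta> > 0\<close> by (simp add: field_simps)
    hence "exp (- 2 * \<delta>\<^sup>2 * real (m n)) \<le> exp (- (4 * ln (real n)))"
      by simp
    also have "\<dots> = 1 / real n ^ 4"
      using elim by (simp add: exp_minus inverse_eq_divide powr_numeral[symmetric] powr_def)
    finally have "real (Suc n) * exp (- 2 * \<delta>\<^sup>2 * real (m n)) \<le> real (Suc n) * (1 / real n ^ 4)"
      by (intro mult_left_mono) auto
    with B_prob[of n] elim show ?case by simp
  qed
  moreover have "summable (\<lambda>n. real (Suc n) / real n ^ 4)"
  proof (rule summable_comparison_test_bigo)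
    show "summable (\<lambda>n. norm (1 / real n ^ 2))"
      using inverse_power_summable[of 2, where 'a = real] by (simp add: field_simps)
    show "(\<lambda>n. real (Suc n) / real n ^ 4) \<in> O(\<lambda>n. 1 / real n ^ 2)"
      by real_asymp
  qed
  ultimately have "summable (\<lambda>n. prob (B n))"
    by (rule summable_comparison_test_ev)
  hence "AE \<omega> in M. \<forall>\<^sub>F n in sequentially. \<omega> \<in> space M - B n"
    by (intro borel_cantelli_AE1) (auto simp: B_sets emeasure_eq_measure)
  thus ?thesis
  proof (rule AE_mp, intro AE_I2 impI)
    fix \<omega> assume "\<forall>\<^sub>F n in sequentially. \<omega> \<in> space M - B n"
    thus "\<forall>\<^sub>F n in sequentially. \<forall>j\<le>n.
           empirical_freq (m n) (\<lambda>i. X n i \<omega>) (A j) < measure_pmf.prob (P n) (A j) + \<delta>"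
      using eventually_ge_at_top[of 2]
      by eventually_elim (auto simp: B_def bad_def not_le)
  qed
qed

section \<open>The error of the first round\<close>

text \<open>
  The condition \<open>x > p\<close> in the definition of \<open>prime_hyp\<close> is what makes every hypothesis correct
  on every prime; a composite multiple of \<open>p\<close> satisfies it automatically.
\<close>

lemma misclassified_iff:
  assumes "prime p" "x \<ge> 2"
  shows "prime_hyp p x \<noteq> prime_label x \<longleftrightarrow> \<not> prime x \<and> \<not> p dvd x"
proof (cases "p dvd x")
  case True
  hence "p \<le> x" using assms by (auto dest: dvd_imp_le)
  have "prime x \<longleftrightarrow> p = x"
    using True assms by (metis primes_dvd_imp_eq)
  thus ?thesis
    using True \<open>p \<le> x\<close> by (auto simp: prime_hyp_def prime_label_def)
qed (auto simp: prime_hyp_def prime_label_def)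

lemma min_error_le: "prime p \<Longrightarrow> min_error m x D \<le> weighted_error m x D (prime_hyp p)"
  unfolding min_error_def hyp_class_def
  by (intro Min_le finite_weighted_error_image) auto

text \<open>
  All sets whose frequencies determine the first error, arranged in one sequence so that a single
  union bound over \<open>{..n}\<close> covers them.  The indices 0 and 1 are not primes and hence are free
  for the two sets that are not of the form \<open>{x. p dvd x}\<close> with \<open>p\<close> prime.
\<close>

definition critical_set :: "nat \<Rightarrow> nat set" where
  "critical_set j = (if j = 0 then {x. prime x} else if j = 1 then {x. odd x} else {x. j dvd x})"

text \<open>The bound is the error of \<open>h\<^sub>2\<close>, enlarged by the odd primes of the sample.\<close>

lemma uniform_min_error_le:
  assumes "\<And>i. i \<in> {1..m} \<Longrightarrow> x i \<ge> 2"
  shows "min_error m x (\<lambda>_. 1 / real m) \<le> empirical_freq m x {x. odd x}"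
proof -
  have "min_error m x (\<lambda>_. 1 / real m) \<le> weighted_error m x (\<lambda>_. 1 / real m) (prime_hyp 2)"
    by (intro min_error_le) simp
  also have "\<dots> \<le> (\<Sum>i=1..m. 1 / real m * of_bool (x i \<in> {x. odd x}))"
    unfolding weighted_error_def using assms
    by (intro sum_mono mult_left_mono) (auto simp: misclassified_iff)
  also have "\<dots> = empirical_freq m x {x. odd x}"
    unfolding empirical_freq_def sum_divide_distrib by simp
  finally show ?thesis .
qed

text \<open>
  The optimal \<open>p\<close> is right only on the primes and on the multiples of \<open>p\<close>.  If \<open>p > n\<close>, then
  the sample contains no multiples of \<open>p\<close>, and so only finitely many frequencies matter.
\<close>

lemma uniform_min_error_ge:
  assumes "m \<ge> 1" and x: "\<And>i. i \<in> {1..m} \<Longrightarrow> x i \<in> {2..n}"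
    and multiples: "\<And>p. prime p \<Longrightarrow> p \<le> n \<Longrightarrow> empirical_freq m x {x. p dvd x} \<le> c" and "c \<ge> 0"
  shows "1 - empirical_freq m x {x. prime x} - c \<le> min_error m x (\<lambda>_. 1 / real m)"
proof -
  obtain p where p: "prime p"
      "weighted_error m x (\<lambda>_. 1 / real m) (prime_hyp p) = min_error m x (\<lambda>_. 1 / real m)"
    using min_error_attained by blast
  have "empirical_freq m x {x. p dvd x} \<le> c"
  proof (cases "p \<le> n")
    case False
    have "\<not> p dvd x i" if "i \<in> {1..m}" for i
      using x[OF that] False by (auto dest!: dvd_imp_le)
    hence "empirical_freq m x {x. p dvd x} = 0"
      by (auto simp: empirical_freq_def)
    thus ?thesis using \<open>c \<ge> 0\<close> by simp
  qed (use p multiples in auto)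
  hence "1 - empirical_freq m x {x. prime x} - c
      \<le> 1 - empirical_freq m x {x. prime x} - empirical_freq m x {x. p dvd x}"
    by simp
  also have "\<dots> = (\<Sum>i=1..m. 1 / real m *
      (1 - of_bool (x i \<in> {x. prime x}) - of_bool (x i \<in> {x. p dvd x})))"
    using \<open>m \<ge> 1\<close>
    by (simp add: empirical_freq_def sum_subtractf diff_divide_distrib flip: sum_divide_distrib)
  also have "\<dots> \<le> weighted_error m x (\<lambda>_. 1 / real m) (prime_hyp p)"
    unfolding weighted_error_def
  proof (intro sum_mono mult_left_mono)
    fix i assume "i \<in> {1..m}"
    hence "x i \<ge> 2" using x by auto
    thus "1 - of_bool (x i \<in> {x. prime x}) - of_bool (x i \<in> {x. p dvd x})
        \<le> (of_bool (prime_hyp p (x i) \<noteq> prime_label (x i)) :: real)"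
      using p(1) by (simp add: misclassified_iff)
  qed auto
  finally show ?thesis using p by simp
qed

lemma uniform_min_error_tendsto_half:
  assumes m: "\<And>n. n \<ge> 2 \<Longrightarrow> m n \<ge> 1"
    and x: "\<And>n i. n \<ge> 2 \<Longrightarrow> i \<in> {1..m n} \<Longrightarrow> x n i \<in> {2..n}"
    and freq: "\<And>\<delta>. \<delta> > 0 \<Longrightarrow> \<forall>\<^sub>F n in sequentially. \<forall>j\<le>n.
      empirical_freq (m n) (x n) (critical_set j)
        < measure_pmf.prob (pmf_of_set {2..n}) (critical_set j) + \<delta>"
  shows "(\<lambda>n. min_error (m n) (x n) (\<lambda>_. 1 / real (m n))) \<longlonglongrightarrow> 1 / 2"
proof (rule order_tendstoI)
  fix a :: real assume a: "1 / 2 < a"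
  hence "\<forall>\<^sub>F n in sequentially. \<forall>j\<le>n. empirical_freq (m n) (x n) (critical_set j)
        < measure_pmf.prob (pmf_of_set {2..n}) (critical_set j) + (a - 1 / 2)"
    by (intro freq) simp
  thus "\<forall>\<^sub>F n in sequentially. min_error (m n) (x n) (\<lambda>_. 1 / real (m n)) < a"
    using eventually_ge_at_top[of 2]
  proof eventually_elim
    case (elim n)
    have "x n i \<ge> 2" if "i \<in> {1..m n}" for i
      using x[OF elim(2) that] by simp
    hence "min_error (m n) (x n) (\<lambda>_. 1 / real (m n)) \<le> empirical_freq (m n) (x n) {x. odd x}"
      by (rule uniform_min_error_le)
    also have "\<dots> < measure_pmf.prob (pmf_of_set {2..n}) {x. odd x} + (a - 1 / 2)"
      using elim by (auto simp: critical_set_def dest!: spec[of _ 1])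
    also have "\<dots> \<le> a"
      using prob_odd_le[OF elim(2)] by simp
    finally show ?case .
  qed
next
  fix a :: real assume a: "a < 1 / 2"
  \<comment> \<open>One \<open>\<delta>\<close> is lost in each of four estimates: the density of the primes, the density of the
    multiples of \<open>p\<close>, and the two deviations of the sample from these densities.\<close>
  define \<delta> where "\<delta> = (1 / 2 - a) / 4"
  have "\<delta> > 0" using a by (simp add: \<delta>_def)
  have "\<forall>\<^sub>F n in sequentially. measure_pmf.prob (pmf_of_set {2..n}) {x. prime x} < \<delta>"
    using prob_prime_tendsto_0 \<open>\<delta> > 0\<close> by (rule order_tendstoD)
  moreover have "(\<lambda>n. (real n / 2) / (real n - 1)) \<longlonglongrightarrow> 1 / 2"
    by real_asymp
  hence "\<forall>\<^sub>F n in sequentially. (real n / 2) / (real n - 1) < 1 / 2 + \<delta>"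
    using \<open>\<delta> > 0\<close> by (intro order_tendstoD) auto
  ultimately show "\<forall>\<^sub>F n in sequentially. a < min_error (m n) (x n) (\<lambda>_. 1 / real (m n))"
    using freq[OF \<open>\<delta> > 0\<close>] eventually_ge_at_top[of 2]
  proof eventually_elim
    case (elim n)
    have "empirical_freq (m n) (x n) {x. prime x} < 2 * \<delta>"
      using elim by (auto simp: critical_set_def dest!: spec[of _ 0])
    moreover have "empirical_freq (m n) (x n) {x. p dvd x} \<le> 1 / 2 + 2 * \<delta>"
      if "prime p" "p \<le> n" for p
    proof -
      have "p \<ge> 2" using that by (simp add: prime_ge_2_nat)
      thus ?thesis
        using elim(3) prob_multiple_le[of n p] elim(2,4) that
        by (auto simp: critical_set_def dest!: spec[of _ p])
    qed
    hence "1 - empirical_freq (m n) (x n) {x. prime x} - (1 / 2 + 2 * \<delta>)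
        \<le> min_error (m n) (x n) (\<lambda>_. 1 / real (m n))"
      using elim m x \<open>\<delta> > 0\<close> by (intro uniform_min_error_ge[where n = n]) auto
    ultimately show ?case
      by (simp add: \<delta>_def field_simps)
  qed
qed

section \<open>Later rounds\<close>

text \<open>
  The deviation from the uniform distribution is measured on an exponential scale, because an
  update multiplies the weights by exponentials: on this scale the deviations simply add.
\<close>

definition near_uniform :: "nat \<Rightarrow> (nat \<Rightarrow> real) \<Rightarrow> real \<Rightarrow> bool" where
  "near_uniform m D d \<longleftrightarrow> (\<forall>i\<in>{1..m}. exp (- d) / real m \<le> D i \<and> D i \<le> exp d / real m)"

lemma weighted_error_near_uniform:
  assumes "near_uniform m D d"
  shows "exp (- d) * weighted_error m x (\<lambda>_. 1 / real m) h \<le> weighted_error m x D h"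
    and "weighted_error m x D h \<le> exp d * weighted_error m x (\<lambda>_. 1 / real m) h"
  using assms unfolding weighted_error_def near_uniform_def sum_distrib_left mult.assoc[symmetric]
  by (intro sum_mono mult_right_mono; simp)+

lemma min_error_near_uniform:
  assumes "near_uniform m D d"
  shows "exp (- d) * min_error m x (\<lambda>_. 1 / real m) \<le> min_error m x D"
    and "min_error m x D \<le> exp d * min_error m x (\<lambda>_. 1 / real m)"
proof -
  obtain p where p: "prime p" "weighted_error m x D (prime_hyp p) = min_error m x D"
    using min_error_attained by blast
  have "exp (- d) * min_error m x (\<lambda>_. 1 / real m)
      \<le> exp (- d) * weighted_error m x (\<lambda>_. 1 / real m) (prime_hyp p)"
    using p by (intro mult_left_mono min_error_le) auto
  also have "\<dots> \<le> min_error m x D"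
    using weighted_error_near_uniform(1)[OF assms] p by metis
  finally show "exp (- d) * min_error m x (\<lambda>_. 1 / real m) \<le> min_error m x D" .
next
  obtain p where p: "prime p"
      "weighted_error m x (\<lambda>_. 1 / real m) (prime_hyp p) = min_error m x (\<lambda>_. 1 / real m)"
    using min_error_attained by blast
  have "min_error m x D \<le> weighted_error m x D (prime_hyp p)"
    using p by (intro min_error_le)
  also have "\<dots> \<le> exp d * min_error m x (\<lambda>_. 1 / real m)"
    using weighted_error_near_uniform(2)[OF assms] p by metis
  finally show "min_error m x D \<le> exp d * min_error m x (\<lambda>_. 1 / real m)" .
qed

text \<open>
  The update multiplies each entry by \<open>exp w\<close> or \<open>exp (- w)\<close>, which costs \<open>d + \<bar>w\<bar>\<close>.  The
  normalizing sum lies between \<open>exp (- (d + \<bar>w\<bar>))\<close> and \<open>exp (d + \<bar>w\<bar>)\<close>, and the division by it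
  costs the same amount again.
\<close>

lemma near_uniform_reweight:
  assumes "near_uniform m D d"
  shows "near_uniform m (reweight m x D) (2 * d + 2 * \<bar>hyp_weight (min_error m x D)\<bar>)"
  unfolding near_uniform_def
proof (intro ballI)
  fix i assume i: "i \<in> {1..m}"
  define w where "w = hyp_weight (min_error m x D)"
  define f where "f = (\<lambda>j. D j * exp (- w * prime_label (x j) * best_hyp m x D (x j)))"
  define c where "c = d + \<bar>w\<bar>"
  have m: "real m > 0" using i by simp
  have margin: "\<bar>- w * prime_label (x j) * best_hyp m x D (x j)\<bar> = \<bar>w\<bar>" for j
    by (auto simp: prime_label_def best_hyp_def prime_hyp_def)
  have f: "exp (- c) / real m \<le> f j \<and> f j \<le> exp c / real m" if "j \<in> {1..m}" for j
  proof -
    define u where "u = - w * prime_label (x j) * best_hyp m x D (x j)"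
    have u: "- \<bar>w\<bar> \<le> u" "u \<le> \<bar>w\<bar>"
      using margin[of j] unfolding u_def[symmetric] by linarith+
    have D: "exp (- d) / real m \<le> D j" "D j \<le> exp d / real m"
      using assms that by (auto simp: near_uniform_def)
    have "0 \<le> D j" using D(1) by (meson divide_nonneg_nonneg exp_ge_zero of_nat_0_le_iff order_trans)
    have "exp (- d) / real m * exp (- \<bar>w\<bar>) \<le> D j * exp u"
      using D u \<open>0 \<le> D j\<close> by (intro mult_mono) auto
    moreover have "D j * exp u \<le> exp d / real m * exp \<bar>w\<bar>"
      using D u \<open>0 \<le> D j\<close> by (intro mult_mono) auto
    ultimately show ?thesis
      by (simp add: f_def c_def u_def exp_add exp_diff exp_minus field_simps)
  qed
  have "(\<Sum>j=1..m. exp (- c) / real m) \<le> sum f {1..m}" "sum f {1..m} \<le> (\<Sum>j=1..m. exp c / real m)"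
    using f by (blast intro: sum_mono)+
  hence S: "exp (- c) \<le> sum f {1..m}" "sum f {1..m} \<le> exp c"
    using m by simp_all
  have Spos: "0 < sum f {1..m}" using S(1) by (meson exp_gt_zero less_le_trans)
  have fi: "0 \<le> f i" using f[OF i] by (meson divide_nonneg_nonneg exp_ge_zero of_nat_0_le_iff order_trans)
  have "exp (- c) / real m / exp c \<le> f i / sum f {1..m}"
    using f[OF i] S Spos fi by (intro frac_le) auto
  moreover have "f i / sum f {1..m} \<le> exp c / real m / exp (- c)"
    using f[OF i] S Spos fi by (intro frac_le) auto
  moreover have "exp (- c) / real m / exp c = exp (- (2 * c)) / real m"
    "exp c / real m / exp (- c) = exp (2 * c) / real m"
    using m by (simp_all add: exp_minus field_simps flip: exp_add)
  moreover have "reweight m x D i = f i / sum f {1..m}"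
    by (simp add: reweight_def f_def w_def Let_def)
  ultimately show "exp (- (2 * d + 2 * \<bar>hyp_weight (min_error m x D)\<bar>)) / real m \<le> reweight m x D i \<and>
      reweight m x D i \<le> exp (2 * d + 2 * \<bar>hyp_weight (min_error m x D)\<bar>) / real m"
    by (simp add: c_def w_def algebra_simps)
qed

lemma hyp_weight_tendsto_0:
  assumes "(e \<longlongrightarrow> 1 / 2) F"
  shows "((\<lambda>n. hyp_weight (e n)) \<longlongrightarrow> 0) F"
proof -
  have "((\<lambda>n. 1 / 2 * ln (1 / e n - 1)) \<longlongrightarrow> 1 / 2 * ln (1 / (1 / 2) - 1)) F"
    by (intro tendsto_intros assms) auto
  thus ?thesis by (simp add: hyp_weight_def)
qed

lemma min_error_near_uniform_tendsto:
  assumes "\<And>n. near_uniform (m n) (D n) (d n)" "(d \<longlongrightarrow> 0) F"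
    and "((\<lambda>n. min_error (m n) (x n) (\<lambda>_. 1 / real (m n))) \<longlongrightarrow> c) F"
  shows "((\<lambda>n. min_error (m n) (x n) (D n)) \<longlongrightarrow> c) F"
proof (rule tendsto_sandwich)
  show "\<forall>\<^sub>F n in F. exp (- d n) * min_error (m n) (x n) (\<lambda>_. 1 / real (m n))
          \<le> min_error (m n) (x n) (D n)"
    and "\<forall>\<^sub>F n in F. min_error (m n) (x n) (D n)
          \<le> exp (d n) * min_error (m n) (x n) (\<lambda>_. 1 / real (m n))"
    using assms(1) by (simp_all add: min_error_near_uniform)
  have "((\<lambda>n. exp (- d n) * min_error (m n) (x n) (\<lambda>_. 1 / real (m n))) \<longlongrightarrow> exp (- 0) * c) F"
    by (intro tendsto_intros assms)
  thus "((\<lambda>n. exp (- d n) * min_error (m n) (x n) (\<lambda>_. 1 / real (m n))) \<longlongrightarrow> c) F"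
    by simp
  have "((\<lambda>n. exp (d n) * min_error (m n) (x n) (\<lambda>_. 1 / real (m n))) \<longlongrightarrow> exp 0 * c) F"
    by (intro tendsto_intros assms)
  thus "((\<lambda>n. exp (d n) * min_error (m n) (x n) (\<lambda>_. 1 / real (m n))) \<longlongrightarrow> c) F"
    by simp
qed

text \<open>
  The deviation satisfies \<open>d\<^sub>k\<^sub>+\<^sub>1 = 2 d\<^sub>k + 2 \<bar>w\<^sub>k\<bar>\<close>.  It may grow exponentially in \<open>k\<close>, but the
  number of rounds is fixed while \<open>n\<close> varies, so it still tends to 0.
\<close>

lemma adaboost_dist_near_uniform:
  assumes "((\<lambda>n. min_error (m n) (x n) (\<lambda>_. 1 / real (m n))) \<longlongrightarrow> 1 / 2) F"
  shows "\<exists>d. (\<forall>n. near_uniform (m n) (adaboost_dist (m n) (x n) k) (d n)) \<and> (d \<longlongrightarrow> 0) F"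
proof (induction k)
  case 0
  show ?case by (rule exI[of _ "\<lambda>_. 0"]) (simp add: near_uniform_def)
next
  case (Suc k)
  then obtain d where d: "\<And>n. near_uniform (m n) (adaboost_dist (m n) (x n) k) (d n)" "(d \<longlongrightarrow> 0) F"
    by blast
  define w where "w = (\<lambda>n. hyp_weight (min_error (m n) (x n) (adaboost_dist (m n) (x n) k)))"
  have "(w \<longlongrightarrow> 0) F"
    unfolding w_def by (intro hyp_weight_tendsto_0 min_error_near_uniform_tendsto[OF d assms])
  hence "((\<lambda>n. 2 * d n + 2 * \<bar>w n\<bar>) \<longlongrightarrow> 2 * 0 + 2 * \<bar>0\<bar>) F"
    by (intro tendsto_intros d)
  moreover have "near_uniform (m n) (adaboost_dist (m n) (x n) (Suc k)) (2 * d n + 2 * \<bar>w n\<bar>)" for n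
    using near_uniform_reweight[OF d(1)] by (simp add: w_def)
  ultimately show ?case by (intro exI[of _ "\<lambda>n. 2 * d n + 2 * \<bar>w n\<bar>"]) simp
qed

text \<open>
  As the errors of the first \<open>t\<close> rounds tend to \<open>1/2\<close>, all of them are eventually nonzero.  The
  procedure then does not stop by round \<open>t\<close>, and the weight is given by the logarithm.
\<close>

lemma adaboost_weight_tendsto_0:
  assumes "((\<lambda>n. min_error (m n) (x n) (\<lambda>_. 1 / real (m n))) \<longlongrightarrow> 1 / 2) F"
  shows "((\<lambda>n. adaboost_weight (m n) (x n) t) \<longlongrightarrow> 0) F"
proof -
  have err: "((\<lambda>n. adaboost_error (m n) (x n) s) \<longlongrightarrow> 1 / 2) F" for s
  proof -
    obtain d where "\<And>n. near_uniform (m n) (adaboost_dist (m n) (x n) (s - 1)) (d n)" "(d \<longlongrightarrow> 0) F"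
      using adaboost_dist_near_uniform[OF assms] by blast
    thus ?thesis unfolding adaboost_error_def
      by (rule min_error_near_uniform_tendsto) fact
  qed
  have "\<forall>\<^sub>F n in F. \<forall>s\<in>{1..t}. adaboost_error (m n) (x n) s \<noteq> 0"
    by (intro eventually_ball_finite ballI tendsto_imp_eventually_ne[OF err]) auto
  hence "\<forall>\<^sub>F n in F. ereal (hyp_weight (adaboost_error (m n) (x n) t)) = adaboost_weight (m n) (x n) t"
    by eventually_elim (auto simp: adaboost_weight_def)
  moreover have "((\<lambda>n. ereal (hyp_weight (adaboost_error (m n) (x n) t))) \<longlongrightarrow> ereal 0) F"
    by (intro tendsto_ereal hyp_weight_tendsto_0 err)
  ultimately show ?thesis
    unfolding zero_ereal_def by (rule Lim_transform_eventually[rotated])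
qed

section \<open>Almost sure convergence of the weights\<close>

theorem theorem2p2:
  fixes M :: "'a measure" and m :: "nat \<Rightarrow> nat" and X :: "nat \<Rightarrow> nat \<Rightarrow> 'a \<Rightarrow> nat"
  assumes "prob_space M"
    and "\<And>n. n \<ge> 2 \<Longrightarrow> m n \<ge> 1"
    and "\<And>n. n \<ge> 2 \<Longrightarrow> prob_space.indep_vars M (\<lambda>_. count_space UNIV) (X n) {1..m n}"
    and "\<And>n i. n \<ge> 2 \<Longrightarrow> i \<in> {1..m n} \<Longrightarrow>
           distr M (count_space UNIV) (X n i) = measure_pmf (pmf_of_set {2..n})"
    and "filterlim (\<lambda>n. real (m n) / (ln (real n)) ^ 3) at_top sequentially"
  shows "\<forall>t\<ge>1. AE \<omega> in M.
           (\<lambda>n. adaboost_weight (m n) (\<lambda>i. X n i \<omega>) t) \<longlonglongrightarrow> 0"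
proof (intro allI impI)
  fix t :: nat
  interpret prob_space M by fact
  have "\<forall>\<^sub>F n in sequentially. ln (real n) \<ge> 1"
    by real_asymp
  hence "\<forall>\<^sub>F n in sequentially. real (m n) / (ln (real n)) ^ 3 \<le> real (m n) / ln (real n)"
  proof eventually_elim
    case (elim n)
    have "ln (real n) ^ 1 \<le> ln (real n) ^ 3"
      using elim by (intro power_increasing) auto
    thus ?case using elim by (intro divide_left_mono) auto
  qed
  with assms(5) have growth: "filterlim (\<lambda>n. real (m n) / ln (real n)) at_top sequentially"
    by (rule filterlim_at_top_mono)
  \<comment> \<open>Only countably many null sets may be discarded, so \<open>\<delta>\<close> runs through the values
    \<open>1 / (l + 1)\<close>.\<close>
  have "AE \<omega> in M. \<forall>l. \<forall>\<^sub>F n in sequentially. \<forall>j\<le>n.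
          empirical_freq (m n) (\<lambda>i. X n i \<omega>) (critical_set j)
            < measure_pmf.prob (pmf_of_set {2..n}) (critical_set j) + 1 / real (Suc l)"
    unfolding AE_all_countable
    by (intro allI AE_eventually_empirical_freq_less assms growth) auto
  moreover have "AE \<omega> in M. \<forall>n i. n \<ge> 2 \<longrightarrow> i \<in> {1..m n} \<longrightarrow> X n i \<omega> \<in> {2..n}"
    unfolding AE_all_countable
  proof (intro allI AE_impI)
    fix n i assume n: "n \<ge> 2" and i: "i \<in> {1..m n}"
    have [measurable]: "X n i \<in> measurable M (count_space UNIV)"
      using assms(3)[OF n] i by (auto simp: indep_vars_def)
    have "AE y in distr M (count_space UNIV) (X n i). y \<in> {2..n}"
      using n by (subst assms(4)[OF n i]) (auto simp: AE_measure_pmf_iff)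
    thus "AE \<omega> in M. X n i \<omega> \<in> {2..n}"
      by (subst (asm) AE_distr_iff) auto
  qed
  ultimately show "AE \<omega> in M. (\<lambda>n. adaboost_weight (m n) (\<lambda>i. X n i \<omega>) t) \<longlonglongrightarrow> 0"
  proof eventually_elim
    case (elim \<omega>)
    have "\<forall>\<^sub>F n in sequentially. \<forall>j\<le>n.
          empirical_freq (m n) (\<lambda>i. X n i \<omega>) (critical_set j)
            < measure_pmf.prob (pmf_of_set {2..n}) (critical_set j) + \<delta>" if "\<delta> > 0" for \<delta>
    proof -
      obtain l where "1 / real (Suc l) < \<delta>"
        using \<open>\<delta> > 0\<close> by (rule nat_approx_posE)
      with elim(1)[rule_format, of l] show ?thesis
        by (elim eventually_mono) force
    qed
    with assms(2) elim(2) show ?case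
      by (intro adaboost_weight_tendsto_0 uniform_min_error_tendsto_half) auto
  qed
qed

end
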